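(* Let $\Gamma$ be a discrete point group in $\mathbb{R}^d$, let $H$ be a finite $\Gamma$-symmetric graph (with free action) and $(H,p)$ a $\Gamma$-symmetric framework, and let $(H/\Gamma,\psi)$ be the quotient $\Gamma$-gain graph. Then $(H,p)$ is symmetrically robust if and only if $$\dim_{\mathbb{R}}\operatorname{span}\{P_{e,\psi}(p/\Gamma)\mid e\in E(H/\Gamma)\}=d\,|V(H)/\Gamma|-1-\dim_{\mathbb{R}}\bigcap_{\gamma\in\Gamma}\ker(I_d-\gamma).$$
   Context: A discrete point group is a finite subgroup $\Gamma$ of the orthogonal group $\mathcal O(\mathbb{R}^d)$. A simple graph $H$ is $\Gamma$-symmetric if $\Gamma$ acts on $H$ by automorphisms, written $v\mapsto\gamma v$; the action is free if $\gamma v\ne v$ for all $v$ and non-identity $\gamma$. The quotient gain graph: pick a representative vertex $v$ in each vertex orbit $\Gamma v$; each edge orbit between orbits $\Gamma u,\Gamma v$ has the form $\{\{gu,ghv\}:g\in\Gamma\}$ for a unique $h\in\Gamma$, and becomes an edge of $H/\Gamma$ directed from $\Gamma u$ to $\Gamma v$ with gain $\psi=h$ (possibly a loop). A map $f:V(H)\to\mathbb{R}^d$ is $\Gamma$-symmetric if $\gamma f(v)=f(\gamma v)$ for all $\gamma,v$; $(H,p)$ is a $\Gamma$-symmetric framework if $p$ is $\Gamma$-symmetric. The quotient $p/\Gamma:V(H/\Gamma)\to\mathbb{R}^d$ is $p/\Gamma(\Gamma v)=p(v)$ for representatives $v$. A relocation of $(H,p)$ is $m:V(H)\to\mathbb{R}^d$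 with $\langle m(i)-m(j),\alpha\rangle=0$ for all $\alpha$ satisfying $\langle p(i)-p(j),\alpha\rangle=0$, for every edge $\{i,j\}$. Translations $m_t(v)=t$ ($t\in\mathbb{R}^d$) and the dilation $m_{\rm di}(v)=p(v)$ are relocations; a relocation is trivial if it is a linear combination of these. $(H,p)$ is symmetrically robust if every $\Gamma$-symmetric relocation is trivial. For a gain graph $(G=(V,E),\psi)$ with gains in $\Gamma$ and $q:V\to\mathbb{R}^d$, for $e$ directed from $i$ to $j$ with $\psi_e=\psi(e)$ (possibly $i=j$): $A_{e,\psi}=\{x\in(\mathbb{R}^d)^V: x(i)+\psi_e x(j)=0,\ x(w)=0\ \forall w\ne i,j\}$ if $e$ is not a loop, $A_{e,\psi}=\{x:\exists\alpha\in\mathbb{R}^d,\ x(i)=(I_d-\psi_e)\alpha,\ x(w)=0\ \forall w\ne i\}$ if $e$ is a loop; and $P_{e,\psi}(q)=A_{e,\psi}\cap\{x\in(\mathbb{R}^d)^V:\langle q(i)-\psi_e q(j),x(i)\rangle=0\}$.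
   Formalization: For a loop e, P_{e,ψ}(q) is taken as {x : x(i)=(I−ψ)α for some α with ⟨q(i)−ψq(i), ψα⟩=0, x(w)=0 for w≠i}, since the printed condition on x(i) makes the claim false when ψ²≠I; and p is assumed nonconstant (so H is nonempty). *)

theory Defs
  imports
    "HOL-Analysis.Analysis"
    "HOL-Algebra.Group_Action"
    "Graph_Theory.Digraph"
begin

section \<open>Discrete point groups\<close>

definition orthogonal_group :: "(real^'d^'d) monoid" where
  "orthogonal_group = \<lparr>carrier = {A. orthogonal_matrix A}, mult = (**), one = mat 1\<rparr>"

definition discrete_point_group :: "(real^'d^'d) set \<Rightarrow> bool" where
  "discrete_point_group \<Gamma> \<longleftrightarrow> finite \<Gamma> \<and> subgroup \<Gamma> orthogonal_group"

abbreviation point_group :: "(real^'d^'d) set \<Rightarrow> (real^'d^'d) monoid" where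
  "point_group \<Gamma> \<equiv> orthogonal_group\<lparr>carrier := \<Gamma>\<rparr>"

section \<open>Symmetric graphs and frameworks\<close>

text \<open>
  A finite simple graph is given by its set \<open>E\<close> of edges; its vertices are all elements of the
  finite type \<open>'v\<close>.
\<close>

definition simple_graph :: "'v::finite set set \<Rightarrow> bool" where
  "simple_graph E \<longleftrightarrow> (\<forall>e\<in>E. \<exists>u v. u \<noteq> v \<and> e = {u, v})"

definition symmetric_graph ::
    "(real^'d^'d) set \<Rightarrow> (real^'d^'d \<Rightarrow> 'v \<Rightarrow> 'v) \<Rightarrow> 'v::finite set set \<Rightarrow> bool" where
  "symmetric_graph \<Gamma> act E \<longleftrightarrow>
     simple_graph E \<and>
     group_action (point_group \<Gamma>) (UNIV :: 'v set) act \<and>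
     (\<forall>\<gamma>\<in>\<Gamma>. \<forall>u v. {act \<gamma> u, act \<gamma> v} \<in> E \<longleftrightarrow> {u, v} \<in> E)"

definition free_action :: "(real^'d^'d) set \<Rightarrow> (real^'d^'d \<Rightarrow> 'v \<Rightarrow> 'v) \<Rightarrow> bool" where
  "free_action \<Gamma> act \<longleftrightarrow> (\<forall>\<gamma>\<in>\<Gamma>. \<gamma> \<noteq> mat 1 \<longrightarrow> (\<forall>v. act \<gamma> v \<noteq> v))"

definition symmetric_map ::
    "(real^'d^'d) set \<Rightarrow> (real^'d^'d \<Rightarrow> 'v \<Rightarrow> 'v) \<Rightarrow> ('v \<Rightarrow> real^'d) \<Rightarrow> bool" where
  "symmetric_map \<Gamma> act f \<longleftrightarrow> (\<forall>\<gamma>\<in>\<Gamma>. \<forall>v. \<gamma> *v f v = f (act \<gamma> v))"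

definition relocation :: "'v set set \<Rightarrow> ('v \<Rightarrow> real^'d) \<Rightarrow> ('v \<Rightarrow> real^'d) \<Rightarrow> bool" where
  "relocation E p m \<longleftrightarrow>
     (\<forall>i j. {i, j} \<in> E \<longrightarrow> (\<forall>\<alpha>. (p i - p j) \<bullet> \<alpha> = 0 \<longrightarrow> (m i - m j) \<bullet> \<alpha> = 0))"

definition trivial_relocation :: "('v::finite \<Rightarrow> real^'d) \<Rightarrow> ('v \<Rightarrow> real^'d) \<Rightarrow> bool" where
  "trivial_relocation p m \<longleftrightarrow>
     (\<chi> v. m v) \<in> span (range (\<lambda>t :: real^'d. \<chi> v. t) \<union> {\<chi> v. p v})"

definition symmetrically_robust ::
    "(real^'d^'d) set \<Rightarrow> (real^'d^'d \<Rightarrow> 'v::finite \<Rightarrow> 'v) \<Rightarrow> 'v set set \<Rightarrow> ('v \<Rightarrow> real^'d) \<Rightarrow> bool"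
  where
  "symmetrically_robust \<Gamma> act E p \<longleftrightarrow>
     (\<forall>m. relocation E p m \<and> symmetric_map \<Gamma> act m \<longrightarrow> trivial_relocation p m)"

section \<open>Quotient gain graphs\<close>

text \<open>
  The vertices of the quotient are the vertex orbits, its arcs are the edge orbits. The predicate
  leaves open the choice of a representative \<open>rep w\<close> of each orbit \<open>w\<close>, and the choice of a
  direction of each arc. A loop \<open>e\<close> can carry either of the gains \<open>h\<close> and \<open>h\<inverse>\<close>; both are
  allowed.
\<close>

definition quotient_gain_graph ::
    "(real^'d^'d) set \<Rightarrow> (real^'d^'d \<Rightarrow> 'v \<Rightarrow> 'v) \<Rightarrow> 'v set set \<Rightarrow> ('v set \<Rightarrow> 'v) \<Rightarrow>
     ('v set, 'v set set) pre_digraph \<Rightarrow> ('v set set \<Rightarrow> real^'d^'d) \<Rightarrow> bool" where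
  "quotient_gain_graph \<Gamma> act E rep G \<psi> \<longleftrightarrow>
     verts G = orbits (point_group \<Gamma>) UNIV act \<and>
     (\<forall>w\<in>verts G. rep w \<in> w) \<and>
     arcs G = {{act g ` e |g. g \<in> \<Gamma>} |e. e \<in> E} \<and>
     (\<forall>e\<in>arcs G. tail G e \<in> verts G \<and> head G e \<in> verts G \<and> \<psi> e \<in> \<Gamma> \<and>
        e = {{act g (rep (tail G e)), act (g ** \<psi> e) (rep (head G e))} |g. g \<in> \<Gamma>})"

section \<open>The subspaces attached to the arcs of a gain graph\<close>

definition A_space ::
    "('w, 'e) pre_digraph \<Rightarrow> ('e \<Rightarrow> real^'d^'d) \<Rightarrow> 'e \<Rightarrow> (real^'d^'w::finite) set" where
  "A_space G \<psi> e =
     (let i = tail G e; j = head G e in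
      if i \<noteq> j then {x. x $ i + \<psi> e *v (x $ j) = 0 \<and> (\<forall>w. w \<noteq> i \<and> w \<noteq> j \<longrightarrow> x $ w = 0)}
      else {x. (\<exists>\<alpha>. x $ i = (mat 1 - \<psi> e) *v \<alpha>) \<and> (\<forall>w. w \<noteq> i \<longrightarrow> x $ w = 0)})"

text \<open>
  An arc \<open>e\<close> from \<open>i\<close> to \<open>j\<close> contributes a vector \<open>a\<close> at its tail and \<open>- \<psi>\<inverse> a\<close> at its head, and
  \<open>P_space\<close> requires \<open>a\<close> to be orthogonal to \<open>q i - \<psi> (q j)\<close>. If \<open>e\<close> is not a loop, then
  \<open>a = x $ i\<close>. At a loop the two contributions add up to \<open>x $ i = a - \<psi>\<inverse> a\<close>, which is
  \<open>(I - \<psi>) \<alpha>\<close> for \<open>a = - \<psi> \<alpha>\<close>; so there the condition is imposed on \<open>\<psi> \<alpha>\<close>.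

  It is tempting to impose it on the sum \<open>x $ i\<close> also at a loop. For \<open>\<psi>\<^sup>2 = I\<close> this is the same
  (lemma \<open>P_space_eq\<close>). Otherwise it gives a different space, which depends on the direction
  chosen for the loop and is not orthogonal to the symmetric relocations: take the plane, the
  rotation \<open>\<psi>\<close> by a right angle and \<open>q i \<noteq> 0\<close>; the dilation is not orthogonal to the line of all
  vectors orthogonal to \<open>q i - \<psi> (q i)\<close>.
\<close>

definition P_space ::
    "('w, 'e) pre_digraph \<Rightarrow> ('e \<Rightarrow> real^'d^'d) \<Rightarrow> ('w \<Rightarrow> real^'d) \<Rightarrow> 'e \<Rightarrow> (real^'d^'w::finite) set"
  where
  "P_space G \<psi> q e =
     (let i = tail G e; j = head G e in
      if i \<noteq> j then A_space G \<psi> e \<inter> {x. (q i - \<psi> e *v q j) \<bullet> (x $ i) = 0}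
      else {x. (\<exists>\<alpha>. x $ i = (mat 1 - \<psi> e) *v \<alpha> \<and> (q i - \<psi> e *v q j) \<bullet> (\<psi> e *v \<alpha>) = 0) \<and>
               (\<forall>w. w \<noteq> i \<longrightarrow> x $ w = 0)})"

lemma P_space_subset_A_space: "P_space G \<psi> q e \<subseteq> A_space G \<psi> e"
  by (auto simp: P_space_def A_space_def Let_def)

lemma P_space_eq:
  fixes \<psi> :: "'e \<Rightarrow> real^'d^'d"
  assumes orth: "orthogonal_matrix (\<psi> e)"
    and "tail G e \<noteq> head G e \<or> \<psi> e ** \<psi> e = mat 1"
  shows "P_space G \<psi> q e =
    A_space G \<psi> e \<inter> {x. (q (tail G e) - \<psi> e *v q (head G e)) \<bullet> (x $ tail G e) = 0}"
proof (cases "tail G e = head G e")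
  case False
  then show ?thesis by (simp add: P_space_def Let_def)
next
  case True
  define i where "i = tail G e"
  with True assms(2) have sq: "\<psi> e ** \<psi> e = mat 1" by simp
  have inv: "\<psi> e *v (\<psi> e *v x) = x" for x
    by (simp add: matrix_vector_mul_assoc sq)
  have isom: "(\<psi> e *v x) \<bullet> (\<psi> e *v y) = x \<bullet> y" for x y
    using orth by (simp add: orthogonal_matrix dot_lmul_matrix flip: transpose_matrix_vector)
      (metis dot_lmul_matrix inner_commute matrix_vector_mul_assoc matrix_vector_mul_lid
        orth orthogonal_matrix vector_transpose_matrix)
  have key: "(q i - \<psi> e *v q i) \<bullet> ((mat 1 - \<psi> e) *v \<alpha>)
      = - 2 * ((q i - \<psi> e *v q i) \<bullet> (\<psi> e *v \<alpha>))" for \<alpha>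
  proof -
    have "(q i - \<psi> e *v q i) \<bullet> \<alpha> = (\<psi> e *v (q i - \<psi> e *v q i)) \<bullet> (\<psi> e *v \<alpha>)"
      by (simp add: isom)
    also have "\<dots> = - ((q i - \<psi> e *v q i) \<bullet> (\<psi> e *v \<alpha>))"
      by (simp add: matrix_vector_mult_diff_distrib inv inner_diff_left)
    finally show ?thesis
      by (simp add: matrix_vector_mult_diff_rdistrib inner_diff_right)
  qed
  show ?thesis
    using True key unfolding P_space_def A_space_def Let_def i_def by force
qed

end

theory Submission
  imports Defs
begin

text \<open>
  Because the action is free, symmetric maps on the vertices correspond to arbitrary vectors indexed
  by the vertex orbits, and such a map is a relocation iff the vector is orthogonal to every
  \<open>P_space\<close>. Hence the dimension of the span of these spaces is the codimension of the
  space of symmetric relocations. The trivial ones among them are the sums of a translation by a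
  \<open>\<Gamma>\<close>-fixed vector and a multiple of \<open>p\<close>, and they form a space of dimension \<open>1\<close> plus that of
  the fixed space. Robustness says that these two nested spaces coincide, i.e. that their dimensions agree.
\<close>

section \<open>Linear algebra and trivial relocations\<close>

lemma inner_transpose_matrix_vector:
  fixes A :: "real^'n^'m"
  shows "x \<bullet> (transpose A *v y) = (A *v x) \<bullet> y"
  by (metis dot_lmul_matrix inner_commute transpose_matrix_vector)

text \<open>The space is spanned by the standard basis vectors whose outer index lies in
  \<open>V\<close>, and each element of \<open>V\<close> contributes \<open>CARD('d)\<close> of
  them.\<close>

lemma dim_supported_vectors:
  fixes V :: "'w::finite set"
  shows "dim {x :: real^'d^'w. \<forall>w. w \<notin> V \<longrightarrow> x $ w = 0} = CARD('d) * card V"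
proof -
  define d :: "(real^'d^'w) set" where "d = (\<lambda>(w, k). axis w (axis k 1)) ` (V \<times> UNIV)"
  have "d \<subseteq> Basis"
    by (auto simp: d_def Basis_vec_def)
  have mem: "axis w (axis k 1) \<in> d \<longleftrightarrow> w \<in> V" for w and k :: 'd
    by (auto simp: d_def axis_eq_axis)
  have "{x :: real^'d^'w. \<forall>w. w \<notin> V \<longrightarrow> x $ w = 0} = {x. \<forall>i\<in>Basis. i \<notin> d \<longrightarrow> x \<bullet> i = 0}"
    (is "?L = ?R")
  proof (intro Set.set_eqI iffI)
    fix x assume "x \<in> ?L"
    then show "x \<in> ?R"
      using mem by (auto simp: Basis_vec_def inner_axis)
  next
    fix x assume x: "x \<in> ?R"
    have "x $ w $ k = 0" if "w \<notin> V" for w k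
    proof -
      have "axis w (axis k 1) \<in> (Basis :: (real^'d^'w) set)"
        by (auto simp: Basis_vec_def)
      then have "x \<bullet> axis w (axis k 1) = 0"
        using x mem that by blast
      then show ?thesis by (simp add: inner_axis)
    qed
    then show "x \<in> ?L" by (simp add: vec_eq_iff)
  qed
  moreover have "card d = card (V \<times> (UNIV :: 'd set))"
    unfolding d_def by (rule card_image) (auto simp: inj_on_def axis_eq_axis)
  ultimately show ?thesis
    using dim_substandard[OF \<open>d \<subseteq> Basis\<close>] by (simp add: card_cartesian_product)
qed

text \<open>The constant maps already form a subspace, so splitting the dilation off the span leaves
  one scalar \<open>c\<close> and one vector \<open>t\<close>.\<close>

lemma trivial_relocation_iff:
  fixes p m :: "'v::finite \<Rightarrow> real^'d"
  shows "trivial_relocation p m \<longleftrightarrow> (\<exists>t c. \<forall>v. m v = t + c *\<^sub>R p v)"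
proof -
  have lin: "linear (\<lambda>t :: real^'d. (\<chi> v. t) :: real^'d^'v)"
    by (rule linearI) (auto simp: vec_eq_iff)
  have sp: "span (range (\<lambda>t :: real^'d. (\<chi> v. t) :: real^'d^'v)) = range (\<lambda>t. \<chi> v. t)"
    using linear_subspace_image[OF lin subspace_UNIV] by (simp add: span_eq_iff)
  have "trivial_relocation p m \<longleftrightarrow>
      (\<exists>c. (\<chi> v. m v) - c *\<^sub>R (\<chi> v. p v) \<in> range (\<lambda>t :: real^'d. (\<chi> v. t) :: real^'d^'v))"
    unfolding trivial_relocation_def Un_insert_right Un_empty_right span_breakdown_eq sp ..
  also have "\<dots> \<longleftrightarrow> (\<exists>t c. \<forall>v. m v = t + c *\<^sub>R p v)"
    by (auto simp: vec_eq_iff image_iff algebra_simps)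
  finally show ?thesis .
qed

section \<open>The arc spaces and their orthogonal complements\<close>

text \<open>
  This description treats loops and non-loops alike: an arc puts \<open>a\<close> at its tail and
  \<open>- \<psi>\<inverse> a\<close> at its head.
\<close>
lemma P_space_eq_image:
  fixes \<psi> :: "'e \<Rightarrow> real^'d^'d"
  assumes "orthogonal_matrix (\<psi> e)"
  shows "P_space G \<psi> q e =
    (\<lambda>a. axis (tail G e) a - axis (head G e) (transpose (\<psi> e) *v a)) `
      {a. (q (tail G e) - \<psi> e *v q (head G e)) \<bullet> a = 0}"
proof -
  define i j and b :: "real^'d" where "i = tail G e" and "j = head G e"
    and "b = q i - \<psi> e *v q j"
  have inv [simp]: "transpose (\<psi> e) *v (\<psi> e *v x) = x" "\<psi> e *v (transpose (\<psi> e) *v x) = x" for x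
    using assms by (simp_all add: matrix_vector_mul_assoc orthogonal_matrix_def del: transpose_matrix_vector)
  have "P_space G \<psi> q e = (\<lambda>a. axis i a - axis j (transpose (\<psi> e) *v a)) ` {a. b \<bullet> a = 0}"
  proof (cases "i = j")
    case False
    then have P: "P_space G \<psi> q e = {x. x $ i + \<psi> e *v (x $ j) = 0 \<and>
        (\<forall>w. w \<noteq> i \<and> w \<noteq> j \<longrightarrow> x $ w = 0) \<and> b \<bullet> (x $ i) = 0}"
      by (auto simp: P_space_def A_space_def Let_def i_def j_def b_def)
    show ?thesis
    proof (intro Set.set_eqI iffI)
      fix x assume "x \<in> P_space G \<psi> q e"
      then have x: "x $ i + \<psi> e *v (x $ j) = 0" "\<And>w. w \<noteq> i \<Longrightarrow> w \<noteq> j \<Longrightarrow> x $ w = 0" "b \<bullet> (x $ i) = 0"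
        by (auto simp: P)
      have "\<psi> e *v (x $ j) = - (x $ i)"
        using x(1) by (metis add_eq_0_iff)
      then have "x $ j = transpose (\<psi> e) *v (- (x $ i))"
        by (metis inv(1))
      also have "\<dots> = - (transpose (\<psi> e) *v (x $ i))"
        by (metis linear_neg matrix_vector_mul_linear)
      finally have "x = axis i (x $ i) - axis j (transpose (\<psi> e) *v (x $ i))"
        using x(2) False by (subst vec_eq_iff) (auto simp: axis_def)
      then show "x \<in> (\<lambda>a. axis i a - axis j (transpose (\<psi> e) *v a)) ` {a. b \<bullet> a = 0}"
        using x(3) by blast
    next
      fix x assume "x \<in> (\<lambda>a. axis i a - axis j (transpose (\<psi> e) *v a)) ` {a. b \<bullet> a = 0}"
      then obtain a where x: "x = axis i a - axis j (transpose (\<psi> e) *v a)" and a: "b \<bullet> a = 0"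
        by blast
      have "x $ i = a" "x $ j = - (transpose (\<psi> e) *v a)"
        using False by (simp_all add: x axis_def del: transpose_matrix_vector)
      moreover have "\<psi> e *v (- (transpose (\<psi> e) *v a)) = - a"
        by (metis inv(2) linear_neg matrix_vector_mul_linear)
      ultimately show "x \<in> P_space G \<psi> q e"
        using a by (simp add: P) (simp add: x axis_def)
    qed
  next
    case True
    then have P: "P_space G \<psi> q e = {x. (\<exists>\<alpha>. x $ i = (mat 1 - \<psi> e) *v \<alpha> \<and> b \<bullet> (\<psi> e *v \<alpha>) = 0) \<and>
        (\<forall>w. w \<noteq> i \<longrightarrow> x $ w = 0)}"
      by (simp add: P_space_def Let_def i_def j_def b_def)
    show ?thesis
    proof (intro Set.set_eqI iffI)
      fix x assume "x \<in> P_space G \<psi> q e"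
      then obtain \<alpha> where x: "x $ i = (mat 1 - \<psi> e) *v \<alpha>" "b \<bullet> (\<psi> e *v \<alpha>) = 0"
          "\<And>w. w \<noteq> i \<Longrightarrow> x $ w = 0"
        by (auto simp: P)
      \<comment> \<open>At a loop both contributions land at \<open>i\<close>; with this choice
        \<open>a - transpose (\<psi> e) *v a\<close> becomes
        \<open>\<alpha> - \<psi> e *v \<alpha>\<close>.\<close>
      define a where "a = - (\<psi> e *v \<alpha>)"
      have "transpose (\<psi> e) *v a = - \<alpha>"
        unfolding a_def by (metis inv(1) linear_neg matrix_vector_mul_linear)
      then have "x = axis i a - axis j (transpose (\<psi> e) *v a)"
        using x(1,3) True
        by (subst vec_eq_iff) (auto simp: axis_def a_def matrix_vector_mult_diff_rdistrib)
      moreover have "b \<bullet> a = 0"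
        using x(2) by (simp add: a_def)
      ultimately show "x \<in> (\<lambda>a. axis i a - axis j (transpose (\<psi> e) *v a)) ` {a. b \<bullet> a = 0}"
        by blast
    next
      fix x assume "x \<in> (\<lambda>a. axis i a - axis j (transpose (\<psi> e) *v a)) ` {a. b \<bullet> a = 0}"
      then obtain a where x: "x = axis i a - axis j (transpose (\<psi> e) *v a)" and a: "b \<bullet> a = 0"
        by blast
      \<comment> \<open>This inverts the substitution \<open>a = - (\<psi> e *v \<alpha>)\<close> of
        the other direction.\<close>
      define \<alpha> where "\<alpha> = - (transpose (\<psi> e) *v a)"
      have \<alpha>: "\<psi> e *v \<alpha> = - a"
        unfolding \<alpha>_def by (metis inv(2) linear_neg matrix_vector_mul_linear)
      have "x $ i = (mat 1 - \<psi> e) *v \<alpha>"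
        using True
        by (simp add: x axis_def matrix_vector_mult_diff_rdistrib \<alpha>) (simp add: \<alpha>_def)
      moreover have "b \<bullet> (\<psi> e *v \<alpha>) = 0"
        using a by (simp add: \<alpha>)
      moreover have "\<forall>w. w \<noteq> i \<longrightarrow> x $ w = 0"
        using True by (simp add: x axis_def)
      ultimately show "x \<in> P_space G \<psi> q e"
        unfolding P by blast
    qed
  qed
  then show ?thesis
    by (simp add: i_def j_def b_def)
qed

text \<open>In the inner product with \<open>y\<close>, the matrix
  \<open>transpose (\<psi> e)\<close> moves across as \<open>\<psi> e\<close>. Orthogonality to an
  arc space thereby becomes the relocation condition of that arc.\<close>

lemma orthogonal_P_space_iff:
  fixes \<psi> :: "'e \<Rightarrow> real^'d^'d"
  assumes "orthogonal_matrix (\<psi> e)"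
  shows "(\<forall>x\<in>P_space G \<psi> q e. orthogonal x y) \<longleftrightarrow>
    (\<forall>\<alpha>. (q (tail G e) - \<psi> e *v q (head G e)) \<bullet> \<alpha> = 0 \<longrightarrow>
      (y $ tail G e - \<psi> e *v (y $ head G e)) \<bullet> \<alpha> = 0)"
proof -
  have "(axis i a - axis j (transpose (\<psi> e) *v a)) \<bullet> y = (y $ i - \<psi> e *v (y $ j)) \<bullet> a" for i j a
    by (simp add: inner_commute[of _ y] inner_diff_left inner_diff_right inner_axis
        inner_transpose_matrix_vector
        del: transpose_matrix_vector)
  then show ?thesis
    by (simp add: P_space_eq_image[where \<psi> = \<psi> and e = e, OF assms] orthogonal_def
        del: transpose_matrix_vector)
qed

section \<open>Group action, orbits and representatives\<close>

locale free_symmetric_framework =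
  fixes \<Gamma> :: "(real^'d^'d) set"
    and act :: "real^'d^'d \<Rightarrow> 'v::finite \<Rightarrow> 'v"
    and E :: "'v set set"
    and p :: "'v \<Rightarrow> real^'d"
    and rep :: "'v set \<Rightarrow> 'v"
    and G :: "('v set, 'v set set) pre_digraph"
    and \<psi> :: "'v set set \<Rightarrow> real^'d^'d"
  assumes point_group: "discrete_point_group \<Gamma>"
    and symmetric: "symmetric_graph \<Gamma> act E"
    and free: "free_action \<Gamma> act"
    and symmetric_p: "symmetric_map \<Gamma> act p"
    and quotient: "quotient_gain_graph \<Gamma> act E rep G \<psi>"
begin

sublocale group_action "point_group \<Gamma>" "UNIV :: 'v set" act
  using symmetric by (simp add: symmetric_graph_def)

sublocale grp: group "point_group \<Gamma>"
  using group_hom by (rule group_hom.axioms)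

lemma orthogonal: "\<gamma> \<in> \<Gamma> \<Longrightarrow> orthogonal_matrix \<gamma>"
  using point_group subgroup.subset
  by (fastforce simp: discrete_point_group_def orthogonal_group_def)

lemma mult_closed: "\<gamma> \<in> \<Gamma> \<Longrightarrow> \<delta> \<in> \<Gamma> \<Longrightarrow> \<gamma> ** \<delta> \<in> \<Gamma>"
  using grp.m_closed[of \<gamma> \<delta>] by (simp add: orthogonal_group_def)

lemma one_closed: "mat 1 \<in> \<Gamma>"
  using grp.one_closed by (simp add: orthogonal_group_def)

lemma act_mult: "\<gamma> \<in> \<Gamma> \<Longrightarrow> \<delta> \<in> \<Gamma> \<Longrightarrow> act (\<gamma> ** \<delta>) v = act \<gamma> (act \<delta> v)"
  using composition_rule[of v \<gamma> \<delta>] by (simp add: orthogonal_group_def)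

lemma act_one: "act (mat 1) v = v"
  using id_eq_one by (simp add: orthogonal_group_def fun_eq_iff)

lemma ex_inverse: "\<gamma> \<in> \<Gamma> \<Longrightarrow> \<exists>\<delta>\<in>\<Gamma>. \<delta> ** \<gamma> = mat 1 \<and> \<gamma> ** \<delta> = mat 1"
  using grp.l_inv_ex[of \<gamma>] grp.inv_closed[of \<gamma>] grp.l_inv[of \<gamma>] grp.r_inv[of \<gamma>]
  by (auto simp: orthogonal_group_def)

text \<open>Multiplying by the inverse of \<open>\<delta>\<close> yields an element that fixes
  \<open>v\<close>, and freeness forces it to be the identity.\<close>

lemma act_inject:
  assumes "\<gamma> \<in> \<Gamma>" "\<delta> \<in> \<Gamma>" "act \<gamma> v = act \<delta> v"
  shows "\<gamma> = \<delta>"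
proof -
  obtain \<epsilon> where \<epsilon>: "\<epsilon> \<in> \<Gamma>" "\<epsilon> ** \<delta> = mat 1" "\<delta> ** \<epsilon> = mat 1"
    using ex_inverse assms by blast
  then have "act (\<epsilon> ** \<gamma>) v = v"
    using assms by (metis act_mult act_one)
  then have "\<epsilon> ** \<gamma> = mat 1"
    using free mult_closed assms \<epsilon> by (auto simp: free_action_def)
  then show ?thesis
    by (metis \<epsilon>(3) matrix_mul_assoc matrix_mul_lid matrix_mul_rid)
qed

lemma inner_action:
  assumes "\<gamma> \<in> \<Gamma>"
  shows "(\<gamma> *v x) \<bullet> (\<gamma> *v y) = x \<bullet> y"
  using orthogonal[OF assms] orthogonal_transformation_matrix[of "(*v) \<gamma>"]
  by (auto simp: orthogonal_transformation_def)

definition orb :: "'v \<Rightarrow> 'v set" where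
  "orb v = {act g v |g. g \<in> \<Gamma>}"

lemma verts_eq: "verts G = range orb"
  using quotient by (auto simp: quotient_gain_graph_def orbits_def orbit_def orb_def)

lemma orb_act: "\<gamma> \<in> \<Gamma> \<Longrightarrow> orb (act \<gamma> v) = orb v"
proof -
  assume \<gamma>: "\<gamma> \<in> \<Gamma>"
  obtain \<delta> where \<delta>: "\<delta> \<in> \<Gamma>" "\<delta> ** \<gamma> = mat 1"
    using ex_inverse \<gamma> by blast
  \<comment> \<open>Right multiplication by \<open>\<delta>\<close> or \<open>\<gamma>\<close>
    re-indexes one orbit as the other.\<close>
  have "act g v = act (g ** \<delta>) (act \<gamma> v)" "g ** \<delta> \<in> \<Gamma>" if "g \<in> \<Gamma>" for g
    using that \<gamma> \<delta> mult_closed act_mult act_one by metis+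
  moreover have "act g (act \<gamma> v) = act (g ** \<gamma>) v" "g ** \<gamma> \<in> \<Gamma>" if "g \<in> \<Gamma>" for g
    using that \<gamma> by (simp_all add: act_mult mult_closed)
  ultimately show ?thesis
    unfolding orb_def by blast
qed

lemma rep_in: "w \<in> verts G \<Longrightarrow> rep w \<in> w"
  using quotient by (simp add: quotient_gain_graph_def)

lemma orb_rep:
  assumes "w \<in> verts G"
  shows "orb (rep w) = w"
proof -
  obtain v where v: "w = orb v"
    using assms by (auto simp: verts_eq)
  then obtain g where "g \<in> \<Gamma>" "rep w = act g v"
    using rep_in[OF assms] by (auto simp: orb_def)
  then show ?thesis
    by (simp add: v orb_act)
qed

lemma ex_act_rep: "\<exists>g\<in>\<Gamma>. v = act g (rep (orb v))"
proof -
  have "v \<in> orb v"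
    using one_closed act_one by (auto simp: orb_def) metis
  also have "orb v = orb (rep (orb v))"
    by (simp add: orb_rep verts_eq)
  finally show ?thesis
    by (auto simp: orb_def)
qed

text \<open>A value prescribed at a representative propagates along its orbit by the group. Freeness
  makes this consistent, because only one group element carries the representative to a given
  vertex.\<close>

lemma symmetric_map_extension:
  fixes f :: "'v set \<Rightarrow> real^'d"
  obtains m where "symmetric_map \<Gamma> act m" "\<And>w. w \<in> verts G \<Longrightarrow> m (rep w) = f w"
proof
  define g where "g v = (SOME g. g \<in> \<Gamma> \<and> v = act g (rep (orb v)))" for v
  define m where "m v = g v *v f (orb v)" for v
  have g: "g v \<in> \<Gamma>" "v = act (g v) (rep (orb v))" for v
    using someI_ex[OF ex_act_rep[of v, unfolded Bex_def]] by (auto simp: g_def)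
  \<comment> \<open>Both group elements carry \<open>rep (orb v)\<close> to
    \<open>act \<gamma> v\<close>, so they coincide.\<close>
  have g_act: "g (act \<gamma> v) = \<gamma> ** g v" if "\<gamma> \<in> \<Gamma>" for \<gamma> v
  proof (rule act_inject)
    show "act (g (act \<gamma> v)) (rep (orb v)) = act (\<gamma> ** g v) (rep (orb v))"
      using g[of v] g(2)[of "act \<gamma> v"] that by (simp add: act_mult orb_act)
  qed (use g that mult_closed in auto)
  show "symmetric_map \<Gamma> act m"
    by (simp add: symmetric_map_def m_def g_act orb_act matrix_vector_mul_assoc)
  show "m (rep w) = f w" if "w \<in> verts G" for w
  proof -
    have "g (rep w) = mat 1"
      using g[of "rep w"] orb_rep[OF that] act_one one_closed by (metis act_inject)
    then show ?thesis
      by (simp add: m_def orb_rep that)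
  qed
qed

lemma symmetric_map_act: "symmetric_map \<Gamma> act m \<Longrightarrow> \<gamma> \<in> \<Gamma> \<Longrightarrow> m (act \<gamma> v) = \<gamma> *v m v"
  by (simp add: symmetric_map_def)

section \<open>Relocations read off the arcs\<close>

lemma arcD:
  assumes "e \<in> arcs G"
  shows "tail G e \<in> verts G" "head G e \<in> verts G" "\<psi> e \<in> \<Gamma>"
    "e = {{act g (rep (tail G e)), act (g ** \<psi> e) (rep (head G e))} |g. g \<in> \<Gamma>}"
  using quotient assms unfolding quotient_gain_graph_def by blast+

text \<open>Invariance keeps every edge orbit inside \<open>E\<close>, and the identity puts every
  edge into its own orbit.\<close>

lemma Union_arcs: "\<Union> (arcs G) = E"
proof -
  have arcs: "arcs G = {{act g ` e |g. g \<in> \<Gamma>} |e. e \<in> E}"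
    using quotient by (simp add: quotient_gain_graph_def)
  have simple: "\<forall>e\<in>E. \<exists>u v. u \<noteq> v \<and> e = {u, v}"
    and inv: "\<And>g u v. g \<in> \<Gamma> \<Longrightarrow> {act g u, act g v} \<in> E \<longleftrightarrow> {u, v} \<in> E"
    using symmetric unfolding symmetric_graph_def simple_graph_def by simp_all
  have act_edge: "act g ` e \<in> E" if "e \<in> E" "g \<in> \<Gamma>" for e g
  proof -
    obtain u v where "e = {u, v}"
      using bspec[OF simple \<open>e \<in> E\<close>] by (elim exE conjE)
    then show ?thesis
      using inv that by simp
  qed
  show ?thesis
  proof (intro equalityI subsetI)
    fix e assume "e \<in> \<Union> (arcs G)"
    then show "e \<in> E"
      using act_edge by (auto simp: arcs)
  next
    fix e assume "e \<in> E"
    moreover have "e = act (mat 1) ` e"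
      by (simp add: act_one)
    ultimately have "e \<in> {act g ` e |g. g \<in> \<Gamma>}" "{act g ` e |g. g \<in> \<Gamma>} \<in> arcs G"
      using one_closed unfolding arcs by blast+
    then show "e \<in> \<Union> (arcs G)"
      by blast
  qed
qed

text \<open>The group acts by isometries and both \<open>m\<close> and \<open>p\<close> are
  symmetric, so the condition at one edge carries over to its whole orbit. One edge per arc
  suffices.\<close>

lemma relocation_iff:
  assumes m: "symmetric_map \<Gamma> act m"
  shows "relocation E p m \<longleftrightarrow>
    (\<forall>e\<in>arcs G. \<forall>\<alpha>. (p (rep (tail G e)) - \<psi> e *v p (rep (head G e))) \<bullet> \<alpha> = 0 \<longrightarrow>
      (m (rep (tail G e)) - \<psi> e *v m (rep (head G e))) \<bullet> \<alpha> = 0)"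
    (is "_ \<longleftrightarrow> (\<forall>e\<in>arcs G. ?R e)")
proof
  assume rel: "relocation E p m"
  show "\<forall>e\<in>arcs G. ?R e"
  proof
    fix e assume e: "e \<in> arcs G"
    \<comment> \<open>This is the edge with \<open>g = mat 1\<close>. Only the fourth
      \<open>e\<close> of the goal, the arc as a set of edges, is unfolded.\<close>
    have "{act (mat 1) (rep (tail G e)), act (mat 1 ** \<psi> e) (rep (head G e))} \<in> e"
      by (subst (4) arcD(4)[OF e]) (use one_closed in blast)
    then have "{rep (tail G e), act (\<psi> e) (rep (head G e))} \<in> E"
      using e Union_arcs by (auto simp: act_one)
    then show "?R e"
      using rel arcD(3)[OF e] unfolding relocation_def
      by (metis symmetric_map_act m symmetric_p)
  qed
next
  assume R: "\<forall>e\<in>arcs G. ?R e"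
  show "relocation E p m"
    unfolding relocation_def
  proof (intro allI impI)
    fix u v \<alpha> assume uv: "{u, v} \<in> E" and \<alpha>: "(p u - p v) \<bullet> \<alpha> = 0"
    obtain e where e: "e \<in> arcs G" "{u, v} \<in> e"
      using uv Union_arcs by blast
    define i j where "i = rep (tail G e)" and "j = rep (head G e)"
    obtain g where g: "g \<in> \<Gamma>" "{u, v} = {act g i, act (g ** \<psi> e) j}"
      using e(2) arcD(4)[OF e(1)] unfolding i_def j_def by blast
    have diff: "f (act g i) - f (act (g ** \<psi> e) j) = g *v (f i - \<psi> e *v f j)"
      if "symmetric_map \<Gamma> act f" for f :: "'v \<Rightarrow> real^'d"
      using that g(1) arcD(3)[OF e(1)]
      by (simp add: act_mult mult_closed symmetric_map_act matrix_vector_mult_diff_distrib)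
    \<comment> \<open>The inverse \<open>h\<close> of the isometry \<open>g\<close> moves the group
      element onto \<open>\<alpha>\<close>, so that the arc condition is used at
      \<open>h *v \<alpha>\<close>.\<close>
    obtain h where h: "h \<in> \<Gamma>" "g ** h = mat 1"
      using ex_inverse g(1) by blast
    have inner: "(g *v x) \<bullet> \<alpha> = x \<bullet> (h *v \<alpha>)" for x
      using inner_action[OF g(1), of x "h *v \<alpha>"] h(2) by (simp add: matrix_vector_mul_assoc)
    \<comment> \<open>Equal doubletons match \<open>u\<close> and \<open>v\<close> with the two
      endpoints only up to order; an exchange merely changes a sign.\<close>
    have swap: "(f u - f v) \<bullet> \<alpha> = 0 \<longleftrightarrow> (f (act g i) - f (act (g ** \<psi> e) j)) \<bullet> \<alpha> = 0"
      for f :: "'v \<Rightarrow> real^'d"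
      using g(2) by (auto simp: doubleton_eq_iff inner_diff_left)
    show "(m u - m v) \<bullet> \<alpha> = 0"
      using \<alpha> R e(1) unfolding swap diff[OF m] diff[OF symmetric_p] inner by (simp add: i_def j_def)
  qed
qed

section \<open>Fixed vectors and symmetric trivial relocations\<close>

definition fixed_space :: "(real^'d) set" where
  "fixed_space = (\<Inter>\<gamma>\<in>\<Gamma>. {x. (mat 1 - \<gamma>) *v x = 0})"

lemma fixed_space_iff: "t \<in> fixed_space \<longleftrightarrow> (\<forall>\<gamma>\<in>\<Gamma>. \<gamma> *v t = t)"
  by (auto simp: fixed_space_def matrix_vector_mult_diff_rdistrib)

lemma subspace_fixed_space: "subspace fixed_space"
  by (auto simp: subspace_def fixed_space_iff matrix_vector_right_distrib matrix_vector_mult_scaleR)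

lemma symmetric_map_translation_dilation:
  assumes "t \<in> fixed_space"
  shows "symmetric_map \<Gamma> act (\<lambda>v. t + c *\<^sub>R p v)"
  using assms symmetric_p
  by (auto simp: symmetric_map_def fixed_space_iff matrix_vector_right_distrib matrix_vector_mult_scaleR)

text \<open>Symmetry of \<open>m\<close> and \<open>p\<close> cancels the dilation term and leaves
  \<open>\<gamma> *v t = t\<close>. Conversely, two symmetric maps that agree on the representatives
  agree everywhere.\<close>

lemma symmetric_trivial_relocation_iff:
  assumes "symmetric_map \<Gamma> act m"
  shows "trivial_relocation p m \<longleftrightarrow>
    (\<exists>t\<in>fixed_space. \<exists>c. \<forall>w\<in>verts G. m (rep w) = t + c *\<^sub>R p (rep w))"
proof
  assume "trivial_relocation p m"
  then obtain t c where m: "\<And>v. m v = t + c *\<^sub>R p v"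
    by (auto simp: trivial_relocation_iff)
  have "\<gamma> *v t = t" if "\<gamma> \<in> \<Gamma>" for \<gamma>
  proof -
    \<comment> \<open>Any vertex serves; one exists because types are nonempty.\<close>
    fix v
    have "\<gamma> *v t + c *\<^sub>R (\<gamma> *v p v) = t + c *\<^sub>R (\<gamma> *v p v)"
      using symmetric_map_act[OF assms that, of v] symmetric_map_act[OF symmetric_p that, of v]
      by (simp add: m matrix_vector_right_distrib matrix_vector_mult_scaleR)
    then show ?thesis by simp
  qed
  then show "\<exists>t\<in>fixed_space. \<exists>c. \<forall>w\<in>verts G. m (rep w) = t + c *\<^sub>R p (rep w)"
    using m fixed_space_iff by blast
next
  assume "\<exists>t\<in>fixed_space. \<exists>c. \<forall>w\<in>verts G. m (rep w) = t + c *\<^sub>R p (rep w)"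
  then obtain t c where t: "t \<in> fixed_space"
    and m: "\<And>w. w \<in> verts G \<Longrightarrow> m (rep w) = t + c *\<^sub>R p (rep w)"
    by blast
  have "m v = t + c *\<^sub>R p v" for v
  proof -
    obtain g where g: "g \<in> \<Gamma>" "v = act g (rep (orb v))"
      using ex_act_rep by blast
    have "m (rep (orb v)) = t + c *\<^sub>R p (rep (orb v))"
      by (simp add: m verts_eq)
    then show ?thesis
      using g symmetric_map_act[OF assms g(1)]
        symmetric_map_act[OF symmetric_map_translation_dilation[OF t] g(1)] by metis
  qed
  then show "trivial_relocation p m"
    by (auto simp: trivial_relocation_iff)
qed

section \<open>Spaces of vectors indexed by the orbits, and their dimensions\<close>

text \<open>
  The coordinates of \<open>real^'d^'v set\<close> are indexed by all sets of vertices, not only by the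
  orbits; hence the restriction to vectors supported on \<open>verts G\<close>.
\<close>
definition supported :: "(real^'d^'v set) set" where
  "supported = {x. \<forall>w. w \<notin> verts G \<longrightarrow> x $ w = 0}"

definition stresses :: "(real^'d^'v set) set" where
  "stresses = span (\<Union>e\<in>arcs G. P_space G \<psi> (\<lambda>w. p (rep w)) e)"

definition quotient_relocations :: "(real^'d^'v set) set" where
  "quotient_relocations = {y \<in> supported. \<forall>x\<in>stresses. orthogonal x y}"

definition trivial_quotient_relocations :: "(real^'d^'v set) set" where
  "trivial_quotient_relocations =
    {y \<in> supported. \<exists>t\<in>fixed_space. \<exists>c. \<forall>w\<in>verts G. y $ w = t + c *\<^sub>R p (rep w)}"

lemma subspace_supported: "subspace supported"
  by (simp add: supported_def subspace_def)

lemma subspace_quotient_relocations: "subspace quotient_relocations"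
  using subspace_inter[OF subspace_supported subspace_orthogonal_to_vectors[of stresses]]
  by (simp add: quotient_relocations_def Collect_conj_eq)

lemma stresses_subset_supported: "stresses \<subseteq> supported"
  unfolding stresses_def
proof (intro span_minimal subspace_supported UN_least)
  fix e assume e: "e \<in> arcs G"
  show "P_space G \<psi> (\<lambda>w. p (rep w)) e \<subseteq> supported"
    using arcD(1,2)[OF e]
    by (auto simp: P_space_eq_image[where \<psi> = \<psi> and e = e, OF orthogonal[OF arcD(3)[OF e]]] supported_def axis_def)
qed

text \<open>The two spaces are orthogonal complements of each other within
  \<open>supported\<close>.\<close>

lemma dim_stresses: "dim stresses + dim quotient_relocations = CARD('d) * card (verts G)"
  using dim_subspace_orthogonal_to_vectors[OF _ subspace_supported stresses_subset_supported]
    dim_supported_vectors[of "verts G", where 'd = 'd]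
  by (simp add: stresses_def quotient_relocations_def supported_def)

lemma relocation_iff_mem:
  assumes m: "symmetric_map \<Gamma> act m" and y: "y \<in> supported"
    and ym: "\<And>w. w \<in> verts G \<Longrightarrow> m (rep w) = y $ w"
  shows "relocation E p m \<longleftrightarrow> y \<in> quotient_relocations"
proof -
  define P where "P = (\<Union>e\<in>arcs G. P_space G \<psi> (\<lambda>w. p (rep w)) e)"
  \<comment> \<open>Orthogonality to a span need only be checked on the generators, each of which
    lies in a single arc space.\<close>
  have "(\<forall>x\<in>span P. orthogonal x y) \<longleftrightarrow> (\<forall>x\<in>P. orthogonal x y)"
    using span_base[of _ P] orthogonal_to_span[of _ P y] orthogonal_commute[of y] by blast
  then have "y \<in> quotient_relocations \<longleftrightarrow>
      (\<forall>e\<in>arcs G. \<forall>x\<in>P_space G \<psi> (\<lambda>w. p (rep w)) e. orthogonal x y)"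
    using y by (simp add: quotient_relocations_def stresses_def P_def)
  also have "\<dots> \<longleftrightarrow> relocation E p m"
    unfolding relocation_iff[OF m]
    by (intro ball_cong refl) (simp add: orthogonal_P_space_iff orthogonal arcD(1-3) ym)
  finally show ?thesis ..
qed

lemma trivial_relocation_iff_mem:
  assumes "symmetric_map \<Gamma> act m" "y \<in> supported"
    and "\<And>w. w \<in> verts G \<Longrightarrow> m (rep w) = y $ w"
  shows "trivial_relocation p m \<longleftrightarrow> y \<in> trivial_quotient_relocations"
  using assms by (simp add: symmetric_trivial_relocation_iff trivial_quotient_relocations_def)

text \<open>Maps and vectors are exchanged along \<open>m (rep w) = y $ w\<close>: extension from
  the representatives gives one direction, restriction to them the other.\<close>

lemma symmetrically_robust_iff_subset:
  "symmetrically_robust \<Gamma> act E p \<longleftrightarrow> quotient_relocations \<subseteq> trivial_quotient_relocations"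
proof
  assume robust: "symmetrically_robust \<Gamma> act E p"
  show "quotient_relocations \<subseteq> trivial_quotient_relocations"
  proof
    fix y assume y: "y \<in> quotient_relocations"
    then have supp: "y \<in> supported"
      by (simp add: quotient_relocations_def)
    obtain m where m: "symmetric_map \<Gamma> act m" "\<And>w. w \<in> verts G \<Longrightarrow> m (rep w) = y $ w"
      using symmetric_map_extension[of "\<lambda>w. y $ w"] by blast
    show "y \<in> trivial_quotient_relocations"
      using relocation_iff_mem[OF m(1) supp m(2)] trivial_relocation_iff_mem[OF m(1) supp m(2)]
        y robust m(1) by (simp add: symmetrically_robust_def)
  qed
next
  assume sub: "quotient_relocations \<subseteq> trivial_quotient_relocations"
  show "symmetrically_robust \<Gamma> act E p"
    unfolding symmetrically_robust_def
  proof (intro allI impI, elim conjE)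
    fix m assume m: "relocation E p m" "symmetric_map \<Gamma> act m"
    \<comment> \<open>Zeros at the indices that are not orbits keep \<open>y\<close> in
      \<open>supported\<close>.\<close>
    define y :: "real^'d^'v set" where "y = (\<chi> w. if w \<in> verts G then m (rep w) else 0)"
    have "y \<in> supported" "\<And>w. w \<in> verts G \<Longrightarrow> m (rep w) = y $ w"
      by (simp_all add: y_def supported_def)
    then show "trivial_relocation p m"
      using m sub relocation_iff_mem[OF m(2)] trivial_relocation_iff_mem[OF m(2)] by blast
  qed
qed

lemma trivial_quotient_relocations_subset:
  "trivial_quotient_relocations \<subseteq> quotient_relocations"
proof
  fix y assume y: "y \<in> trivial_quotient_relocations"
  then obtain t c where t: "t \<in> fixed_space" and yt: "\<And>w. w \<in> verts G \<Longrightarrow> y $ w = t + c *\<^sub>R p (rep w)"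
    and supp: "y \<in> supported"
    by (auto simp: trivial_quotient_relocations_def)
  \<comment> \<open>Along every edge, the difference of this map is \<open>c\<close> times the
    difference of \<open>p\<close>.\<close>
  have "relocation E p (\<lambda>v. t + c *\<^sub>R p v)"
    by (simp add: relocation_def flip: scaleR_diff_right)
  then show "y \<in> quotient_relocations"
    using relocation_iff_mem[OF symmetric_map_translation_dilation[OF t] supp] yt by simp
qed

text \<open>The translations by fixed vectors embed injectively through \<open>L\<close>, and the
  dilation \<open>r\<close> adds one dimension. If \<open>p\<close> were constant, the dilation
  would itself be such a translation.\<close>

lemma trivial_quotient_relocations_dim:
  assumes "\<exists>u v. p u \<noteq> p v"
  shows "subspace trivial_quotient_relocations"
    and "dim trivial_quotient_relocations = dim fixed_space + 1"
proof -
  define L :: "real^'d \<Rightarrow> real^'d^'v set" where "L t = (\<chi> w. if w \<in> verts G then t else 0)" for t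
  define r :: "real^'d^'v set" where "r = (\<chi> w. if w \<in> verts G then p (rep w) else 0)"
  have lin: "linear L"
    by (rule linearI) (auto simp: L_def vec_eq_iff)
  \<comment> \<open>At least one orbit exists, so \<open>L t\<close> has a coordinate equal to
    \<open>t\<close>.\<close>
  have "orb undefined \<in> verts G"
    by (simp add: verts_eq)
  then have "inj L"
    by (auto simp: inj_def L_def vec_eq_iff)
  have span_L: "span (L ` fixed_space) = L ` fixed_space"
    using linear_subspace_image[OF lin subspace_fixed_space] by (simp add: span_eq_iff)
  have "y \<in> trivial_quotient_relocations \<longleftrightarrow> (\<exists>c. y - c *\<^sub>R r \<in> L ` fixed_space)" for y
  proof -
    have "(y \<in> supported \<and> (\<forall>w\<in>verts G. y $ w = t + c *\<^sub>R p (rep w))) \<longleftrightarrow> y - c *\<^sub>R r = L t" for t c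
      by (auto simp: supported_def L_def r_def vec_eq_iff algebra_simps)
    then show ?thesis
      unfolding trivial_quotient_relocations_def by blast
  qed
  then have eq: "trivial_quotient_relocations = span (insert r (L ` fixed_space))"
    by (auto simp: span_breakdown_eq span_L)
  then show "subspace trivial_quotient_relocations"
    by simp
  have "r \<notin> L ` fixed_space"
  proof
    assume "r \<in> L ` fixed_space"
    then obtain t where t: "t \<in> fixed_space" "r = L t"
      by blast
    \<comment> \<open>The map \<open>p\<close> takes the value \<open>t\<close> at every
      representative, and since \<open>t\<close> is fixed by the group, on every whole
      orbit.\<close>
    have "p v = t" for v
    proof -
      obtain g where g: "g \<in> \<Gamma>" "v = act g (rep (orb v))"
        using ex_act_rep by blast
      have "p (rep (orb v)) = r $ orb v"
        by (simp add: r_def verts_eq)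
      also have "\<dots> = t"
        by (simp add: t(2) L_def verts_eq)
      finally show ?thesis
        using g t(1) symmetric_map_act[OF symmetric_p g(1)] by (metis fixed_space_iff)
    qed
    with assms show False by simp
  qed
  then have "dim trivial_quotient_relocations = dim (L ` fixed_space) + 1"
    by (simp add: eq dim_insert span_L)
  also have "dim (L ` fixed_space) = dim fixed_space"
    using dim_image_eq[OF lin] \<open>inj L\<close> by (simp add: inj_on_subset)
  finally show "dim trivial_quotient_relocations = dim fixed_space + 1" .
qed

end

theorem theorem6p2:
  fixes \<Gamma> :: "(real^'d^'d) set"
    and act :: "real^'d^'d \<Rightarrow> 'v::finite \<Rightarrow> 'v"
    and E :: "'v set set"
    and p :: "'v \<Rightarrow> real^'d"
    and rep :: "'v set \<Rightarrow> 'v"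
    and G :: "('v set, 'v set set) pre_digraph"
    and \<psi> :: "'v set set \<Rightarrow> real^'d^'d"
  assumes "discrete_point_group \<Gamma>"
    and "symmetric_graph \<Gamma> act E"
    and "free_action \<Gamma> act"
    and "symmetric_map \<Gamma> act p"
    and "quotient_gain_graph \<Gamma> act E rep G \<psi>"
    and nonconstant: "\<exists>u v. p u \<noteq> p v"
  shows "symmetrically_robust \<Gamma> act E p \<longleftrightarrow>
    int (dim (span (\<Union>e\<in>arcs G. P_space G \<psi> (\<lambda>w. p (rep w)) e))) =
    int CARD('d) * int (card (verts G)) - 1
      - int (dim (\<Inter>\<gamma>\<in>\<Gamma>. {x :: real^'d. (mat 1 - \<gamma>) *v x = 0}))"
proof -
  interpret free_symmetric_framework \<Gamma> act E p rep G \<psi>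
    using assms by unfold_locales
  \<comment> \<open>The inclusion of the trivial space always holds, so robustness means equality,
    which for nested subspaces is equality of dimensions.\<close>
  have "symmetrically_robust \<Gamma> act E p \<longleftrightarrow>
      dim quotient_relocations = dim trivial_quotient_relocations"
    unfolding symmetrically_robust_iff_subset
    using subspace_dim_equal[OF trivial_quotient_relocations_dim(1)[OF nonconstant]
        subspace_quotient_relocations trivial_quotient_relocations_subset]
      trivial_quotient_relocations_subset by (metis order_antisym order_refl)
  also have "\<dots> \<longleftrightarrow> dim quotient_relocations = dim fixed_space + 1"
    by (simp add: trivial_quotient_relocations_dim(2)[OF nonconstant])
  \<comment> \<open>Integers prevent truncated subtraction on the right-hand side.\<close>
  also have "\<dots> \<longleftrightarrow> int (dim stresses) =
      int CARD('d) * int (card (verts G)) - 1 - int (dim fixed_space)"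
    using dim_stresses by (simp flip: of_nat_mult) linarith
  finally show ?thesis
    by (simp add: stresses_def fixed_space_def)
qed

end
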